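(* Any subgroup of $PL_0(I)$ is either abelian or contains a subgroup isomorphic to the restricted wreath product $\mathbf{Z}\wr\mathbf{Z}$.
   Context: $I=[0,1]$. $PL_0(I)$ is the group, under composition, of all orientation-preserving piecewise linear continuous transformations (homeomorphisms) of $I$ onto itself having only finitely many breaks of the derivative. $\mathbf{Z}\wr\mathbf{Z}$ is the restricted wreath product of two infinite cyclic groups: the semidirect product of $\bigoplus_{i\in\mathbf{Z}}\mathbf{Z}$ with $\mathbf{Z}$ acting by the shift. *)

theory Defs
  imports "HOL-Analysis.Analysis" "HOL-Algebra.Algebra"
begin

definition affine_on :: "real set \<Rightarrow> (real \<Rightarrow> real) \<Rightarrow> bool" where
  "affine_on S f \<longleftrightarrow> (\<exists>m c. \<forall>x\<in>S. f x = m * x + c)"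

text \<open>\<open>B\<close> is a finite set containing all breaks of the derivative: \<open>f\<close> is affine on every closed
  subinterval of \<open>[0,1]\<close> with no point of \<open>B\<close> in its interior.\<close>

definition piecewise_linear_01 :: "(real \<Rightarrow> real) \<Rightarrow> bool" where
  "piecewise_linear_01 f \<longleftrightarrow>
     (\<exists>B. finite B \<and>
        (\<forall>a b. 0 \<le> a \<and> a < b \<and> b \<le> 1 \<and> {a<..<b} \<inter> B = {} \<longrightarrow> affine_on {a..b} f))"

text \<open>As in \<^const>\<open>BijGroup\<close>, maps of \<open>[0,1]\<close> are represented by functions that are
  \<^const>\<open>undefined\<close> elsewhere, so that each map has a unique representative.\<close>

definition PL0_maps :: "(real \<Rightarrow> real) set" where
  "PL0_maps = {f \<in> extensional {0..1}.
     (\<exists>g. homeomorphism {0..1} {0..1} f g) \<and> strict_mono_on {0..1} f \<and> piecewise_linear_01 f}"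

definition PL0 :: "(real \<Rightarrow> real) monoid" where
  "PL0 = (BijGroup {0..1})\<lparr>carrier := PL0_maps\<rparr>"

definition semidirect_product ::
    "('a, 'c) monoid_scheme \<Rightarrow> ('b, 'd) monoid_scheme \<Rightarrow> ('b \<Rightarrow> 'a \<Rightarrow> 'a) \<Rightarrow> ('a \<times> 'b) monoid" where
  "semidirect_product N H \<phi> =
     \<lparr>carrier = carrier N \<times> carrier H,
      monoid.mult = (\<lambda>(n1, h1) (n2, h2). (n1 \<otimes>\<^bsub>N\<^esub> \<phi> h1 n2, h1 \<otimes>\<^bsub>H\<^esub> h2)),
      one = (\<one>\<^bsub>N\<^esub>, \<one>\<^bsub>H\<^esub>)\<rparr>"

definition Z_wr_Z :: "((int \<Rightarrow> int) \<times> int) monoid" where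
  "Z_wr_Z = semidirect_product (sum_group (UNIV :: int set) (\<lambda>_. integer_group)) integer_group
              (\<lambda>k f i. f (i - k))"

lemma affine_onI: "(\<And>x. x \<in> S \<Longrightarrow> f x = m * x + c) \<Longrightarrow> affine_on S f"
  unfolding affine_on_def by blast

lemma PL0_maps_subset_Bij: "PL0_maps \<subseteq> Bij {0..1}"
proof
  fix f assume "f \<in> PL0_maps"
  then obtain g where ext: "f \<in> extensional {0..1}" and fg: "homeomorphism {0..1} {0..1} f g"
    by (auto simp: PL0_maps_def)
  have "bij_betw f {0..1} {0..1}"
    by (rule bij_betw_byWitness[where f' = g]) (use fg in \<open>auto simp: homeomorphism_def\<close>)
  then show "f \<in> Bij {0..1}" using ext by (simp add: Bij_def)
qed

lemma PL0_maps_strict_mono: "f \<in> PL0_maps \<Longrightarrow> strict_mono_on {0..1} f"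
  by (simp add: PL0_maps_def)

lemma PL0_maps_range: "f \<in> PL0_maps \<Longrightarrow> x \<in> {0..1} \<Longrightarrow> f x \<in> {0..1}"
  by (metis Bij_imp_funcset PL0_maps_subset_Bij PiE subsetD)

lemma PL0_maps_breaks:
  assumes "f \<in> PL0_maps"
  obtains B where "finite B"
    "\<forall>a b. 0 \<le> a \<and> a < b \<and> b \<le> 1 \<and> {a<..<b} \<inter> B = {} \<longrightarrow> affine_on {a..b} f"
proof -
  have "piecewise_linear_01 f" using assms by (simp add: PL0_maps_def)
  then show thesis
    unfolding piecewise_linear_01_def by (elim exE conjE) (rule that)
qed

lemma id_in_PL0_maps: "(\<lambda>x\<in>{0..1}. x) \<in> PL0_maps"
proof -
  have "homeomorphism {0..1} {0..1} (\<lambda>x\<in>{0..1::real}. x) (\<lambda>x. x)"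
    by (rule homeomorphism_cong[OF homeomorphism_ident]) auto
  moreover have "piecewise_linear_01 (\<lambda>x\<in>{0..1}. x)"
    unfolding piecewise_linear_01_def
    by (rule exI[of _ "{}"]) (auto intro!: affine_onI[where m = 1 and c = 0])
  ultimately show ?thesis
    by (auto simp: PL0_maps_def strict_mono_on_def)
qed

lemma compose_in_PL0_maps:
  assumes f: "f \<in> PL0_maps" and g: "g \<in> PL0_maps"
  shows "compose {0..1} f g \<in> PL0_maps"
proof -
  let ?h = "compose {0..1::real} f g"
  obtain f' g' where fg: "homeomorphism {0..1} {0..1} f f'" "homeomorphism {0..1} {0..1} g g'"
    using f g by (auto simp: PL0_maps_def)
  have "homeomorphism {0..1} {0..1} ?h (g' \<circ> f')"
    by (rule homeomorphism_cong[OF homeomorphism_compose[OF fg(2) fg(1)]])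
       (auto simp: compose_def)
  moreover have "strict_mono_on {0..1} ?h"
  proof (rule strict_mono_onI)
    fix x y :: real assume xy: "x \<in> {0..1}" "y \<in> {0..1}" "x < y"
    have "g x < g y" using PL0_maps_strict_mono[OF g] xy by (rule strict_mono_onD)
    then have "f (g x) < f (g y)"
      by (rule strict_mono_onD[OF PL0_maps_strict_mono[OF f] PL0_maps_range[OF g xy(1)] PL0_maps_range[OF g xy(2)]])
    then show "?h x < ?h y" using xy by (simp add: compose_def)
  qed
  moreover have "piecewise_linear_01 ?h"
  proof -
    obtain Bf where Bf: "finite Bf"
      "\<forall>a b. 0 \<le> a \<and> a < b \<and> b \<le> 1 \<and> {a<..<b} \<inter> Bf = {} \<longrightarrow> affine_on {a..b} f"
      using PL0_maps_breaks[OF f] .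
    obtain Bg where Bg: "finite Bg"
      "\<forall>a b. 0 \<le> a \<and> a < b \<and> b \<le> 1 \<and> {a<..<b} \<inter> Bg = {} \<longrightarrow> affine_on {a..b} g"
      using PL0_maps_breaks[OF g] .
    let ?B = "Bg \<union> g' ` Bf"
    have "affine_on {a..b} ?h" if ab: "0 \<le> a" "a < b" "b \<le> 1" "{a<..<b} \<inter> ?B = {}" for a b
    proof -
      have I: "{a..b} \<subseteq> {0..1}" using ab by auto
      have a01: "a \<in> {0..1}" and b01: "b \<in> {0..1}" using ab by auto
      have mono: "g x < g y" if "x \<in> {0..1}" "y \<in> {0..1}" "x < y" for x y
        by (rule strict_mono_onD[OF PL0_maps_strict_mono[OF g] that])
      have mono_le: "g x \<le> g y" if "x \<in> {0..1}" "y \<in> {0..1}" "x \<le> y" for x y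
        using mono[OF that(1,2)] that(3) by (metis order_le_less)
      have r: "g a \<in> {0..1}" "g b \<in> {0..1}" "g a < g b"
        using PL0_maps_range[OF g a01] PL0_maps_range[OF g b01] mono[OF a01 b01 ab(2)] by blast+
      have "{g a<..<g b} \<inter> Bf = {}"
      proof (rule ccontr)
        assume "{g a<..<g b} \<inter> Bf \<noteq> {}"
        then obtain y where "y \<in> {g a<..<g b}" and yB: "y \<in> Bf" by blast
        then have y: "g a < y" "y < g b" "y \<in> Bf" by simp_all
        have y01: "y \<in> {0..1}" using y(1,2) r(1,2) by simp
        have e: "g (g' y) = y" and m: "g' y \<in> {0..1}"
          using fg(2) y01 by (auto simp: homeomorphism_def)
        have "a < g' y"
          by (rule ccontr) (use mono_le[OF m a01] e y(1) in \<open>simp add: not_less\<close>)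
        moreover have "g' y < b"
          by (rule ccontr) (use mono_le[OF b01 m] e y(2) in \<open>simp add: not_less\<close>)
        ultimately have "g' y \<in> {a<..<b} \<inter> ?B" using y(3) by simp
        then show False unfolding ab(4) by (rule emptyE)
      qed
      then have "affine_on {g a..g b} f"
        by (intro Bf(2)[rule_format]) (use r in simp)
      then obtain m c where mc: "\<And>x. x \<in> {g a..g b} \<Longrightarrow> f x = m * x + c"
        unfolding affine_on_def by blast
      have "{a<..<b} \<inter> Bg = {}" using ab(4) by blast
      then have "affine_on {a..b} g"
        by (intro Bg(2)[rule_format]) (use ab in simp)
      then obtain m' c' where mc': "\<And>x. x \<in> {a..b} \<Longrightarrow> g x = m' * x + c'"
        unfolding affine_on_def by blast
      show ?thesis
      proof (rule affine_onI[where m = "m * m'" and c = "m * c' + c"])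
        fix x assume x: "x \<in> {a..b}"
        have x01: "x \<in> {0..1}" using x I by blast
        have "g x \<in> {g a..g b}" using x mono_le[OF a01 x01] mono_le[OF x01 b01] by simp
        then have "f (g x) = m * g x + c" by (rule mc)
        also have "\<dots> = m * m' * x + (m * c' + c)"
          unfolding mc'[OF x] by (simp add: algebra_simps)
        finally show "?h x = m * m' * x + (m * c' + c)"
          using x01 by (simp add: compose_def)
      qed
    qed
    then show ?thesis
      unfolding piecewise_linear_01_def using Bf(1) Bg(1)
      by (intro exI[of _ ?B] conjI allI impI) simp_all
  qed
  ultimately show ?thesis unfolding PL0_maps_def by (blast intro: compose_extensional)
qed

lemma inv_in_PL0_maps:
  assumes f: "f \<in> PL0_maps"
  shows "(\<lambda>x\<in>{0..1}. inv_into {0..1} f x) \<in> PL0_maps"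
proof -
  let ?g = "\<lambda>x\<in>{0..1::real}. inv_into {0..1} f x"
  obtain f' where ff': "homeomorphism {0..1} {0..1} f f'"
    using f by (auto simp: PL0_maps_def)
  have inj: "inj_on f {0..1}" and im: "f ` {0..1} = {0..1}"
    using f PL0_maps_subset_Bij by (auto simp: Bij_def bij_betw_def)
  have eq: "?g x = f' x" if "x \<in> {0..1}" for x
    using that ff' inj by (auto simp: homeomorphism_def intro!: inv_into_f_eq)
  have hom: "homeomorphism {0..1} {0..1} ?g f"
    by (rule homeomorphism_cong[OF homeomorphism_symD[OF ff']]) (use eq in auto)
  have g01: "?g x \<in> {0..1}" "f (?g x) = x" if "x \<in> {0..1}" for x
    using hom that by (auto simp: homeomorphism_def)
  have gf: "?g (f x) = x" if "x \<in> {0..1}" for x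
    using hom that by (auto simp: homeomorphism_def)
  have mono_f: "f x < f y" if "x \<in> {0..1}" "y \<in> {0..1}" "x < y" for x y
    by (rule strict_mono_onD[OF PL0_maps_strict_mono[OF f] that])
  have mono: "?g x < ?g y" if "x \<in> {0..1}" "y \<in> {0..1}" "x < y" for x y
    using mono_f[OF g01(1)[OF that(2)] g01(1)[OF that(1)]] g01(2)[OF that(1)] g01(2)[OF that(2)] that
    by (metis less_irrefl less_linear less_trans)
  have "piecewise_linear_01 ?g"
  proof -
    obtain B where B: "finite B"
      "\<forall>a b. 0 \<le> a \<and> a < b \<and> b \<le> 1 \<and> {a<..<b} \<inter> B = {} \<longrightarrow> affine_on {a..b} f"
      using PL0_maps_breaks[OF f] .
    have "affine_on {a..b} ?g" if ab: "0 \<le> a" "a < b" "b \<le> 1" "{a<..<b} \<inter> f ` B = {}" for a b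
    proof -
      have ab01: "a \<in> {0..1}" "b \<in> {0..1}" using ab by auto
      let ?a = "?g a" and ?b = "?g b"
      have r: "?a \<in> {0..1}" "?b \<in> {0..1}" "?a < ?b"
        using g01(1)[OF ab01(1)] g01(1)[OF ab01(2)] mono[OF ab01 ab(2)] by blast+
      have "{?a<..<?b} \<inter> B = {}"
      proof (rule ccontr)
        assume "{?a<..<?b} \<inter> B \<noteq> {}"
        then obtain y where "y \<in> {?a<..<?b}" and yB: "y \<in> B" by blast
        then have y: "?a < y" "y < ?b" "y \<in> B" unfolding greaterThanLessThan_iff by blast+
        have y01: "y \<in> {0..1}" using y(1,2) r(1,2) by (meson atLeastAtMost_iff less_imp_le order_trans)
        have "a < f y" using mono_f[OF r(1) y01 y(1)] g01(2)[OF ab01(1)] by simp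
        moreover have "f y < b" using mono_f[OF y01 r(2) y(2)] g01(2)[OF ab01(2)] by simp
        ultimately have "f y \<in> {a<..<b} \<inter> f ` B" using y(3) by simp
        then show False unfolding ab(4) by (rule emptyE)
      qed
      moreover have "0 \<le> ?a" "?b \<le> 1" using r(1,2) unfolding atLeastAtMost_iff by blast+
      ultimately have "affine_on {?a..?b} f"
        using r(3) by (intro B(2)[rule_format] conjI)
      then obtain m c where mc: "\<And>x. x \<in> {?a..?b} \<Longrightarrow> f x = m * x + c"
        unfolding affine_on_def by blast
      have fa: "a = m * ?a + c" and fb: "b = m * ?b + c"
        using mc[of ?a] mc[of ?b] g01(2)[OF ab01(1)] g01(2)[OF ab01(2)] less_imp_le[OF r(3)]
        by (metis atLeastAtMost_iff order_refl)+
      have m: "m \<noteq> 0" using fa fb ab(2) by (metis add_0 less_irrefl mult_zero_left)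
      show ?thesis
      proof (rule affine_onI[where m = "1 / m" and c = "- c / m"])
        fix x assume x: "x \<in> {a..b}"
        have x01: "x \<in> {0..1}" using x ab by auto
        have "?a \<le> ?g x"
          using mono[OF ab01(1) x01] x by (metis atLeastAtMost_iff less_eq_real_def)
        moreover have "?g x \<le> ?b"
          using mono[OF x01 ab01(2)] x by (metis atLeastAtMost_iff less_eq_real_def)
        ultimately have "f (?g x) = m * ?g x + c" using mc by (meson atLeastAtMost_iff)
        then have "x = m * ?g x + c" using g01(2)[OF x01] by simp
        then have "m * ?g x = x - c" by linarith
        then have "?g x = (x - c) / m" using m by (metis nonzero_mult_div_cancel_left)
        then show "?g x = 1 / m * x + - c / m" by (simp add: diff_divide_distrib)
      qed
    qed
    then show ?thesis
      unfolding piecewise_linear_01_def using B(1)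
      by (intro exI[of _ "f ` B"] conjI allI impI) simp_all
  qed
  moreover have "strict_mono_on {0..1} ?g" using mono unfolding strict_mono_on_def by blast
  ultimately show ?thesis using hom unfolding PL0_maps_def by blast
qed

lemma subgroup_PL0_maps: "subgroup PL0_maps (BijGroup {0..1})"
proof (rule subgroup.intro)
  show "PL0_maps \<subseteq> carrier (BijGroup {0..1})"
    using PL0_maps_subset_Bij by (simp add: BijGroup_def)
  show "\<one>\<^bsub>BijGroup {0..1}\<^esub> \<in> PL0_maps"
    using id_in_PL0_maps by (simp add: BijGroup_def)
  fix f assume f: "f \<in> PL0_maps"
  then have fB: "f \<in> Bij {0..1}" using PL0_maps_subset_Bij by blast
  show "inv\<^bsub>BijGroup {0..1}\<^esub> f \<in> PL0_maps"
    unfolding inv_BijGroup[OF fB] by (rule inv_in_PL0_maps[OF f])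
  fix g assume g: "g \<in> PL0_maps"
  then have "g \<in> Bij {0..1}" using PL0_maps_subset_Bij by blast
  then show "f \<otimes>\<^bsub>BijGroup {0..1}\<^esub> g \<in> PL0_maps"
    using compose_in_PL0_maps[OF f g] fB by (simp add: BijGroup_def)
qed

lemma group_PL0: "group PL0"
  unfolding PL0_def by (rule subgroup.subgroup_is_group[OF subgroup_PL0_maps group_BijGroup])

lemma group_semidirect_product:
  assumes N: "group N" and H: "group H"
    and hom: "\<And>h. h \<in> carrier H \<Longrightarrow> \<phi> h \<in> hom N N"
    and one: "\<And>n. n \<in> carrier N \<Longrightarrow> \<phi> \<one>\<^bsub>H\<^esub> n = n"
    and mult: "\<And>h k n. h \<in> carrier H \<Longrightarrow> k \<in> carrier H \<Longrightarrow> n \<in> carrier N \<Longrightarrow>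
                 \<phi> (h \<otimes>\<^bsub>H\<^esub> k) n = \<phi> h (\<phi> k n)"
  shows "group (semidirect_product N H \<phi>)"
proof -
  interpret N: group N by fact
  interpret H: group H by fact
  have cl: "\<phi> h n \<in> carrier N" if "h \<in> carrier H" "n \<in> carrier N" for h n
    using hom[OF that(1)] that(2) by (auto simp: hom_def)
  have hm: "\<phi> h (n \<otimes>\<^bsub>N\<^esub> n') = \<phi> h n \<otimes>\<^bsub>N\<^esub> \<phi> h n'"
    if "h \<in> carrier H" "n \<in> carrier N" "n' \<in> carrier N" for h n n'
    using hom[OF that(1)] that by (auto simp: hom_def)
  let ?G = "semidirect_product N H \<phi>"
  show ?thesis
  proof (rule groupI)
    fix x y assume "x \<in> carrier ?G" "y \<in> carrier ?G"
    then show "x \<otimes>\<^bsub>?G\<^esub> y \<in> carrier ?G"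
      by (auto simp: semidirect_product_def cl)
  next
    show "\<one>\<^bsub>?G\<^esub> \<in> carrier ?G" by (simp add: semidirect_product_def)
  next
    fix x y z assume "x \<in> carrier ?G" "y \<in> carrier ?G" "z \<in> carrier ?G"
    then show "x \<otimes>\<^bsub>?G\<^esub> y \<otimes>\<^bsub>?G\<^esub> z = x \<otimes>\<^bsub>?G\<^esub> (y \<otimes>\<^bsub>?G\<^esub> z)"
      by (auto simp: semidirect_product_def cl hm mult N.m_assoc H.m_assoc)
  next
    fix x assume "x \<in> carrier ?G"
    then show "\<one>\<^bsub>?G\<^esub> \<otimes>\<^bsub>?G\<^esub> x = x"
      by (auto simp: semidirect_product_def one)
  next
    fix x assume "x \<in> carrier ?G"
    then obtain n h where x: "x = (n, h)" "n \<in> carrier N" "h \<in> carrier H"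
      by (auto simp: semidirect_product_def)
    let ?k = "inv\<^bsub>H\<^esub> h"
    let ?y = "(\<phi> ?k (inv\<^bsub>N\<^esub> n), ?k)"
    have k: "?k \<in> carrier H" using x by simp
    have "\<phi> ?k (inv\<^bsub>N\<^esub> n) \<otimes>\<^bsub>N\<^esub> \<phi> ?k n = \<phi> ?k (inv\<^bsub>N\<^esub> n \<otimes>\<^bsub>N\<^esub> n)"
      using hm[OF k, of "inv\<^bsub>N\<^esub> n" n] x by simp
    also have "\<dots> = \<phi> ?k \<one>\<^bsub>N\<^esub>" using x by simp
    also have "\<dots> = \<one>\<^bsub>N\<^esub>" by (rule hom_one[OF hom[OF k] N N])
    finally have "?y \<otimes>\<^bsub>?G\<^esub> x = \<one>\<^bsub>?G\<^esub>"
      using x by (simp add: semidirect_product_def)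
    moreover have "?y \<in> carrier ?G" using x k cl by (simp add: semidirect_product_def)
    ultimately show "\<exists>y\<in>carrier ?G. y \<otimes>\<^bsub>?G\<^esub> x = \<one>\<^bsub>?G\<^esub>" by blast
  qed
qed

lemma group_Z_wr_Z: "group Z_wr_Z"
  unfolding Z_wr_Z_def
proof (rule group_semidirect_product)
  fix k :: int
  have "finite {i. f (i - k) \<noteq> 0}" if "finite {i. f i \<noteq> 0}" for f :: "int \<Rightarrow> int"
  proof -
    have "{i. f (i - k) \<noteq> 0} = (\<lambda>i. i + k) ` {i. f i \<noteq> 0}"
      by (force simp: image_iff)
    then show ?thesis using that by simp
  qed
  then show "(\<lambda>f i. f (i - k)) \<in> hom (sum_group UNIV (\<lambda>_. integer_group)) (sum_group UNIV (\<lambda>_. integer_group))"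
    by (auto simp: hom_def carrier_sum_group)
next
  fix h k :: int and f :: "int \<Rightarrow> int"
  show "(\<lambda>i. f (i - (h \<otimes>\<^bsub>integer_group\<^esub> k))) = (\<lambda>i. f (i - h - k))"
    by (simp add: diff_diff_eq)
qed simp_all

end

theory Submission
  imports Defs
begin

text \<open>
  Let \<open>H\<close> be a nonabelian group of piecewise linear homeomorphisms of the interval. The global
  fixpoints of \<open>H\<close> form a closed set, and \<open>H\<close> preserves each component of its open complement. A
  commutator of elements of \<open>H\<close> is the identity near every global fixpoint \<open>p\<close>: on either side of
  \<open>p\<close> both elements are linear maps with centre \<open>p\<close>, and such maps commute
  (\<open>locally_trivial_commutator\<close>). So the support of a commutator has compact closure inside that
  complement and meets only finitely many components.

  Among all nontrivial elements of \<open>H\<close> that are the identity near the global fixpoints, let \<open>w\<close> be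
  one whose support meets the fewest components, and let \<open>C\<close> be a component it meets. The part of
  the support in \<open>C\<close> lies in some \<open>[c, d] \<subseteq> C\<close>. The supremum of the orbit of \<open>c\<close> is a global
  fixpoint, hence lies outside \<open>C\<close>, so some \<open>h \<in> H\<close> carries \<open>c\<close> beyond \<open>d\<close>
  (\<open>component_expanding_element\<close>). Then for \<open>i \<noteq> 0\<close> the supports of \<open>w\<close> and of the conjugate
  \<open>h\<^sup>i w h\<^sup>-\<^sup>i\<close> are disjoint inside \<open>C\<close>, and the commutator of these two elements is trivial
  on \<open>C\<close>. It is also trivial on each component that the support of \<open>w\<close> misses. It thus meets fewer
  components than \<open>w\<close> does, and by minimality it is the identity on all of \<open>[0,1]\<close>: every conjugate
  \<open>h\<^sup>i w h\<^sup>-\<^sup>i\<close> commutes with \<open>w\<close>.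

  Finally \<open>w\<close> and \<open>h\<close> generate \<open>\<int> \<wr> \<int>\<close>, with \<open>h\<close> shifting the commuting conjugates of \<open>w\<close>. That
  there are no further relations is seen at a single point \<open>x \<in> C\<close> moved by \<open>w\<close>: it is fixed by all
  the other conjugates, whereas every nonzero power of \<open>w\<close> moves it. The lemma \<open>wreath_criterion\<close>
  carries this out in an arbitrary group, with the stabilizer of \<open>x\<close> as the subgroup \<open>T\<close>.
\<close>

section \<open>Recognising the wreath product in a group\<close>

context group
begin

definition centralizer :: "'a set \<Rightarrow> 'a set" where
  "centralizer S = {u \<in> carrier G. \<forall>s\<in>S. u \<otimes> s = s \<otimes> u}"

lemma subgroup_centralizer:
  assumes "S \<subseteq> carrier G"
  shows "subgroup (centralizer S) G"
proof (rule subgroupI)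
  fix u v assume uv: "u \<in> centralizer S" "v \<in> centralizer S"
  have "u \<otimes> v \<otimes> s = s \<otimes> (u \<otimes> v)" if "s \<in> S" for s
  proof -
    have c: "u \<in> carrier G" "v \<in> carrier G" "s \<in> carrier G" "u \<otimes> s = s \<otimes> u" "v \<otimes> s = s \<otimes> v"
      using uv that assms by (auto simp: centralizer_def)
    have "u \<otimes> v \<otimes> s = (u \<otimes> s) \<otimes> v" using c(1,2,3,5) by (simp add: m_assoc)
    then show ?thesis using c by (simp add: m_assoc)
  qed
  then show "u \<otimes> v \<in> centralizer S"
    using uv by (simp add: centralizer_def)
next
  fix u assume u: "u \<in> centralizer S"
  have "inv u \<otimes> s = s \<otimes> inv u" if "s \<in> S" for s
  proof -
    have c: "u \<in> carrier G" "s \<in> carrier G" "s \<otimes> u = u \<otimes> s"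
      using u that assms by (auto simp: centralizer_def)
    have "inv u \<otimes> s = inv u \<otimes> (s \<otimes> u) \<otimes> inv u"
      using c(1,2) by (simp add: m_assoc)
    also have "\<dots> = s \<otimes> inv u"
      unfolding c(3) using c(1,2) by (simp flip: m_assoc)
    finally show ?thesis .
  qed
  then show "inv u \<in> centralizer S"
    using u by (simp add: centralizer_def)
next
  show "centralizer S \<noteq> {}"
    using assms by (auto simp: centralizer_def intro!: exI[of _ "\<one>"])
qed (auto simp: centralizer_def)

text \<open>The double centralizer of a commuting set \<open>S\<close> serves as the commutative subgroup: \<open>S\<close> lies in
  its own centralizer, so the double centralizer does too, and hence its elements commute with one
  another. A commutative subgroup is what gives finite products of elements of \<open>S\<close> a meaning that
  is independent of the order.\<close>

lemma commuting_set_in_comm_subgroup: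
  assumes S: "S \<subseteq> carrier G" and comm: "\<And>s t. s \<in> S \<Longrightarrow> t \<in> S \<Longrightarrow> s \<otimes> t = t \<otimes> s"
  obtains A where "subgroup A G" "S \<subseteq> A" "comm_group (G\<lparr>carrier := A\<rparr>)"
proof
  let ?A = "centralizer (centralizer S)"
  have C: "centralizer S \<subseteq> carrier G" by (auto simp: centralizer_def)
  show sub: "subgroup ?A G" by (rule subgroup_centralizer[OF C])
  show "S \<subseteq> ?A" using S by (auto simp: centralizer_def)
  have "S \<subseteq> centralizer S" using S comm by (auto simp: centralizer_def)
  then have "?A \<subseteq> centralizer S" by (auto simp: centralizer_def)
  then have "u \<otimes> v = v \<otimes> u" if "u \<in> ?A" "v \<in> ?A" for u v
    using that by (auto simp: centralizer_def)
  then show "comm_group (G\<lparr>carrier := ?A\<rparr>)"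
    by (intro group.group_comm_groupI subgroup.subgroup_is_group[OF sub]) (simp_all add: is_group)
qed

definition conj_pow :: "'a \<Rightarrow> int \<Rightarrow> 'a \<Rightarrow> 'a" where
  "conj_pow h i u = h [^] i \<otimes> u \<otimes> h [^] (- i)"

lemma conj_pow_closed [simp]:
  "h \<in> carrier G \<Longrightarrow> u \<in> carrier G \<Longrightarrow> conj_pow h i u \<in> carrier G"
  by (simp add: conj_pow_def)

lemma conj_pow_0 [simp]: "h \<in> carrier G \<Longrightarrow> u \<in> carrier G \<Longrightarrow> conj_pow h 0 u = u"
  by (simp add: conj_pow_def)

lemma conj_pow_conj_pow:
  assumes "h \<in> carrier G" "u \<in> carrier G"
  shows "conj_pow h i (conj_pow h j u) = conj_pow h (i + j) u"
proof -
  have "h [^] (i + j) = h [^] i \<otimes> h [^] j" "h [^] (- (i + j)) = h [^] (- j) \<otimes> h [^] (- i)"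
    using assms by (simp_all add: algebra_simps flip: int_pow_mult)
  then show ?thesis using assms by (simp add: conj_pow_def m_assoc)
qed

lemma conj_pow_mult:
  assumes "h \<in> carrier G" "u \<in> carrier G" "v \<in> carrier G"
  shows "conj_pow h i (u \<otimes> v) = conj_pow h i u \<otimes> conj_pow h i v"
proof -
  have "h [^] (- i) \<otimes> (h [^] i \<otimes> x) = x" if "x \<in> carrier G" for x
    using assms that by (simp add: int_pow_neg flip: m_assoc)
  then show ?thesis using assms by (simp add: conj_pow_def m_assoc)
qed

lemma conj_pow_hom: "h \<in> carrier G \<Longrightarrow> group_hom G G (conj_pow h i)"
  by (auto simp: group_hom_def group_hom_axioms_def hom_def conj_pow_mult is_group)

lemma conj_pow_swap:
  assumes "h \<in> carrier G" "u \<in> carrier G"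
  shows "h [^] (i::int) \<otimes> u = conj_pow h i u \<otimes> h [^] i"
  using assms by (simp add: conj_pow_def m_assoc int_pow_neg)

text \<open>The isomorphism sends \<open>(f, k)\<close> to \<open>(\<Prod>i. (h\<^sup>i w h\<^sup>-\<^sup>i)\<^bsup>f i\<^esup>) h\<^sup>k\<close>. The subgroup \<open>T\<close>
  separates \<open>w\<close> from its other conjugates: if a product of powers of the conjugates is trivial, then
  the power of \<open>w\<close> in it equals the inverse of a product of elements of \<open>T\<close>, so its exponent is \<open>0\<close>;
  conjugation by powers of \<open>h\<close> carries this to the other exponents. No nonzero power \<open>h\<^sup>k\<close> is a
  product of conjugates of \<open>w\<close>, since it would then commute with \<open>w\<close>, and \<open>w = h\<^sup>k w h\<^sup>-\<^sup>k\<close>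
  would lie in \<open>T\<close>.\<close>

lemma wreath_criterion:
  assumes w: "w \<in> carrier G" and h: "h \<in> carrier G"
    and comm: "\<And>i. 0 < i \<Longrightarrow> w \<otimes> conj_pow h i w = conj_pow h i w \<otimes> w"
    and T: "subgroup T G"
    and others: "\<And>i. i \<noteq> 0 \<Longrightarrow> conj_pow h i w \<in> T"
    and base: "\<And>n::nat. 0 < n \<Longrightarrow> w [^] n \<notin> T"
  shows "\<exists>K. subgroup K G \<and> G\<lparr>carrier := K\<rparr> \<cong> Z_wr_Z"
proof -
  let ?w = "\<lambda>i. conj_pow h i w"
  let ?supp = "\<lambda>f::int \<Rightarrow> int. {i. f i \<noteq> 0}"
  have comm_less: "?w i \<otimes> ?w j = ?w j \<otimes> ?w i" if "i < j" for i j
    using arg_cong[OF comm[of "j - i"], of "conj_pow h i"] that w h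
    by (simp add: conj_pow_mult conj_pow_conj_pow)
  then have comm_all: "?w i \<otimes> ?w j = ?w j \<otimes> ?w i" for i j
    by (metis linorder_less_linear)
  obtain A where A: "subgroup A G" "range ?w \<subseteq> A" "comm_group (G\<lparr>carrier := A\<rparr>)"
    by (rule commuting_set_in_comm_subgroup[of "range ?w"]) (use w h comm_all in auto)
  let ?B = "G\<lparr>carrier := A\<rparr>"
  interpret A: subgroup A G by fact
  interpret B: comm_group ?B by fact
  have wpow: "?w i [^] (k::int) \<in> A" for i k
    by (rule subgroup_int_pow_closed[OF A(1)]) (use A(2) in blast)
  let ?P = "\<lambda>f S. finprod ?B (\<lambda>i. ?w i [^] (f i :: int)) S"
  define \<psi> where "\<psi> f = ?P f (?supp f)" for f
  have PA: "?P f S \<in> A" for f S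
    using B.finprod_closed[of "\<lambda>i. ?w i [^] f i" S] wpow by auto
  have PG: "?P f S \<in> carrier G" for f S using PA A.subset by blast
  have psi_superset: "\<psi> f = ?P f S" if "finite S" "?supp f \<subseteq> S" for f S
    unfolding \<psi>_def
    by (rule B.finprod_mono_neutral_cong_left) (use that wpow in auto)
  have Pinsert: "?P f (insert i S) = ?w i [^] f i \<otimes> ?P f S" if "finite S" "i \<notin> S" for f i S
    using B.finprod_insert[of S i "\<lambda>i. ?w i [^] f i"] that wpow by auto
  have psi_mult: "\<psi> (\<lambda>i. f i + g i) = \<psi> f \<otimes> \<psi> g" if "finite (?supp f)" "finite (?supp g)" for f g
  proof -
    let ?S = "?supp f \<union> ?supp g"
    have "\<psi> (\<lambda>i. f i + g i) = ?P (\<lambda>i. f i + g i) ?S"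
      by (rule psi_superset) (use that in auto)
    also have "\<dots> = finprod ?B (\<lambda>i. ?w i [^] f i \<otimes>\<^bsub>?B\<^esub> ?w i [^] g i) ?S"
      by (rule B.finprod_cong') (use w h wpow in \<open>auto simp: int_pow_mult\<close>)
    also have "\<dots> = ?P f ?S \<otimes>\<^bsub>?B\<^esub> ?P g ?S"
      by (rule B.finprod_multf) (use wpow in auto)
    also have "\<dots> = \<psi> f \<otimes> \<psi> g"
      using psi_superset[of ?S f] psi_superset[of ?S g] that by simp
    finally show ?thesis .
  qed
  have conj_P: "conj_pow h k (?P f S) = finprod ?B (\<lambda>i. ?w (i + k) [^] f i) S" if "finite S" for k f S
    using that
  proof (induction S)
    case empty
    interpret group_hom G G "conj_pow h k" by (rule conj_pow_hom[OF h])
    show ?case using hom_one by simp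
  next
    case (insert i S)
    interpret group_hom G G "conj_pow h k" by (rule conj_pow_hom[OF h])
    have "finprod ?B (\<lambda>i. ?w (i + k) [^] f i) (insert i S)
        = ?w (i + k) [^] f i \<otimes> finprod ?B (\<lambda>i. ?w (i + k) [^] f i) S"
      using B.finprod_insert[of S i "\<lambda>i. ?w (i + k) [^] f i"] insert.hyps wpow by auto
    moreover have "conj_pow h k (?w i [^] f i) = ?w (i + k) [^] f i"
      using hom_int_pow[of "?w i" "f i"] w h by (simp add: conj_pow_conj_pow add.commute)
    ultimately show ?case
      using insert w h PG by (simp add: Pinsert conj_pow_mult)
  qed
  have psi_shift: "\<psi> (\<lambda>i. f (i - k)) = conj_pow h k (\<psi> f)" if "finite (?supp f)" for f k
  proof -
    have s: "?supp (\<lambda>i. f (i - k)) = (\<lambda>i. i + k) ` ?supp f" by (force simp: image_iff)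
    show ?thesis
      unfolding \<psi>_def s conj_P[OF that]
      by (subst B.finprod_reindex) (use wpow in \<open>auto simp: inj_on_def\<close>)
  qed
  have PT: "?P f S \<in> T" if "finite S" "0 \<notin> S" for f S
    using that
  proof (induction S)
    case empty
    show ?case using subgroup.one_closed[OF T] by simp
  next
    case (insert i S)
    have "?w i [^] f i \<in> T"
      using others[of i] insert.prems by (auto intro: subgroup_int_pow_closed[OF T])
    then show ?case
      using insert subgroup.m_closed[OF T] by (simp add: Pinsert)
  qed
  have pow_T: "k = 0" if "w [^] (k::int) \<in> T" for k
  proof (rule ccontr)
    assume k: "k \<noteq> 0"
    have "w [^] (- k) \<in> T"
      using subgroup.m_inv_closed[OF T that] w by (simp add: int_pow_neg)
    then have "w [^] \<bar>k\<bar> \<in> T" using that by (simp add: abs_if)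
    then have "w [^] nat \<bar>k\<bar> \<in> T" by (simp flip: int_pow_int)
    then show False using base[of "nat \<bar>k\<bar>"] k by simp
  qed
  have zero_coeff: "f 0 = 0" if fin: "finite (?supp f)" and one: "\<psi> f = \<one>" for f
  proof -
    let ?S = "?supp f - {0}"
    have "\<one> = ?P f (insert 0 ?S)" using psi_superset[of "insert 0 ?S" f] fin one by auto
    also have "\<dots> = w [^] f 0 \<otimes> ?P f ?S" using fin w h by (subst Pinsert) auto
    finally have "w [^] f 0 = inv (?P f ?S)"
      using w PG by (metis int_pow_closed inv_equality)
    then have "w [^] f 0 \<in> T" using subgroup.m_inv_closed[OF T PT[of ?S f]] fin by simp
    then show ?thesis by (rule pow_T)
  qed
  have psi_inj: "f = (\<lambda>i. 0)" if fin: "finite (?supp f)" and one: "\<psi> f = \<one>" for f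
  proof
    fix j
    let ?g = "\<lambda>i. f (i - - j)"
    interpret group_hom G G "conj_pow h (- j)" by (rule conj_pow_hom[OF h])
    have "\<psi> ?g = \<one>" using psi_shift[OF fin, of "- j"] one hom_one by simp
    moreover have "?supp ?g = (\<lambda>i. i - j) ` ?supp f" by (force simp: image_iff)
    ultimately show "f j = 0" using zero_coeff[of ?g] fin by simp
  qed
  have carrier_Z: "carrier Z_wr_Z = {f. finite (?supp f)} \<times> UNIV"
    by (auto simp: Z_wr_Z_def semidirect_product_def carrier_sum_group)
  have mult_Z: "(f, k) \<otimes>\<^bsub>Z_wr_Z\<^esub> (g, l) = (\<lambda>i. f i + g (i - k), k + l)" for f g k l
    by (simp add: Z_wr_Z_def semidirect_product_def fun_eq_iff)
  have one_Z: "\<one>\<^bsub>Z_wr_Z\<^esub> = (\<lambda>i. 0, 0)"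
    by (simp add: Z_wr_Z_def semidirect_product_def fun_eq_iff)
  define \<phi> where "\<phi> = (\<lambda>(f, k::int). \<psi> f \<otimes> h [^] k)"
  have psiG: "\<psi> f \<in> carrier G" for f using PG by (simp add: \<psi>_def)
  have hom: "\<phi> \<in> hom Z_wr_Z G"
  proof (rule homI)
    fix x y assume "x \<in> carrier Z_wr_Z" "y \<in> carrier Z_wr_Z"
    then obtain f k g l where xy: "x = (f, k)" "y = (g, l)" and fin: "finite (?supp f)" "finite (?supp g)"
      by (auto simp: carrier_Z)
    have "?supp (\<lambda>i. g (i - k)) = (\<lambda>i. i + k) ` ?supp g" by (force simp: image_iff)
    then have "\<psi> (\<lambda>i. f i + g (i - k)) = \<psi> f \<otimes> conj_pow h k (\<psi> g)"
      using psi_mult[of f "\<lambda>i. g (i - k)"] psi_shift[of g k] fin by simp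
    then have "\<phi> (x \<otimes>\<^bsub>Z_wr_Z\<^esub> y) = \<psi> f \<otimes> (conj_pow h k (\<psi> g) \<otimes> h [^] k) \<otimes> h [^] l"
      using h psiG by (simp add: xy mult_Z \<phi>_def int_pow_mult m_assoc)
    also have "\<dots> = \<phi> x \<otimes> \<phi> y"
      using h psiG by (simp add: xy \<phi>_def m_assoc flip: conj_pow_swap)
    finally show "\<phi> (x \<otimes>\<^bsub>Z_wr_Z\<^esub> y) = \<phi> x \<otimes> \<phi> y" .
  qed (use h psiG in \<open>auto simp: \<phi>_def\<close>)
  interpret \<phi>: group_hom Z_wr_Z G \<phi>
    using hom group_Z_wr_Z is_group by (simp add: group_hom_def group_hom_axioms_def)
  have "x = \<one>\<^bsub>Z_wr_Z\<^esub>" if x: "x \<in> carrier Z_wr_Z" and one: "\<phi> x = \<one>" for x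
  proof -
    obtain f k where fk: "x = (f, k)" "finite (?supp f)" using x by (auto simp: carrier_Z)
    have e: "\<psi> f \<otimes> h [^] k = \<one>" using one by (simp add: fk \<phi>_def)
    have "k = 0"
    proof (rule ccontr)
      assume "k \<noteq> 0"
      have "h [^] k = inv (\<psi> f)"
        using h psiG e inv_equality[OF e] by (metis int_pow_closed inv_inv)
      also have "\<dots> \<in> A" using PA by (simp add: \<psi>_def)
      finally have hA: "h [^] k \<in> A" .
      have wA: "w \<in> A" using A(2) w h conj_pow_0[of h w] by (metis rangeI subsetD)
      have "h [^] k \<otimes> w = w \<otimes> h [^] k" using B.m_comm[of "h [^] k" w] hA wA by simp
      then have "?w k = w" using w h by (simp add: conj_pow_def m_assoc int_pow_neg)
      then have "w \<in> T" using others[OF \<open>k \<noteq> 0\<close>] by simp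
      then show False using base[of 1] w by simp
    qed
    moreover from this have "f = (\<lambda>i. 0)" using psi_inj fk(2) e psiG by simp
    ultimately show ?thesis by (simp add: fk one_Z)
  qed
  then have inj: "inj_on \<phi> (carrier Z_wr_Z)" by (auto simp: \<phi>.inj_on_one_iff)
  let ?K = "\<phi> ` carrier Z_wr_Z"
  have "\<phi> \<in> iso Z_wr_Z (G\<lparr>carrier := ?K\<rparr>)"
    using hom inj by (auto simp: iso_def hom_def bij_betw_def)
  then have "Z_wr_Z \<cong> G\<lparr>carrier := ?K\<rparr>" by (rule is_isoI)
  then have "G\<lparr>carrier := ?K\<rparr> \<cong> Z_wr_Z" by (rule group.iso_sym[OF group_Z_wr_Z])
  then show ?thesis using \<phi>.img_is_subgroup by blast
qed

end

section \<open>Germs of piecewise linear maps and components of open sets\<close>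

lemma PL0_map_germ_at_fixpoint:
  assumes u: "u \<in> PL0_maps" and p: "p \<in> {0..1}" "u p = p"
  obtains \<epsilon> m m' where "0 < \<epsilon>"
    "\<And>x. x \<in> {0..1} \<Longrightarrow> \<bar>x - p\<bar> < \<epsilon> \<Longrightarrow> u x = p + (if p \<le> x then m else m') * (x - p)"
proof -
  obtain B where B: "finite B"
    "\<forall>a b. 0 \<le> a \<and> a < b \<and> b \<le> 1 \<and> {a<..<b} \<inter> B = {} \<longrightarrow> affine_on {a..b} u"
    using PL0_maps_breaks[OF u] .
  obtain \<epsilon> where \<epsilon>: "0 < \<epsilon>" "\<And>b. b \<in> B \<Longrightarrow> b \<noteq> p \<Longrightarrow> \<epsilon> \<le> dist p b"
    using finite_set_avoid[OF B(1), of p] by blast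
  \<comment> \<open>The interval may degenerate to the point \<open>p\<close>: this happens on the outer side of an endpoint.\<close>
  have slope: "\<exists>m. \<forall>x\<in>{a..b}. u x = p + m * (x - p)"
    if "0 \<le> a" "b \<le> 1" "p \<in> {a..b}" "{a<..<b} \<inter> B = {}" for a b
  proof (cases "a = b")
    case True
    then show ?thesis using that p by auto
  next
    case False
    then have "affine_on {a..b} u" using that B(2) by auto
    then obtain m c where mc: "\<And>x. x \<in> {a..b} \<Longrightarrow> u x = m * x + c"
      unfolding affine_on_def by blast
    then have "p = m * p + c" using that(3) p(2) by metis
    then have "c = p - m * p" by simp
    then have "\<forall>x\<in>{a..b}. u x = p + m * (x - p)" using mc by (simp add: algebra_simps)
    then show ?thesis ..
  qed
  obtain m where m: "\<And>x. x \<in> {p..min 1 (p + \<epsilon>)} \<Longrightarrow> u x = p + m * (x - p)"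
    using slope[of p "min 1 (p + \<epsilon>)"] p \<epsilon> by (force simp: dist_real_def)
  obtain m' where m': "\<And>x. x \<in> {max 0 (p - \<epsilon>)..p} \<Longrightarrow> u x = p + m' * (x - p)"
    using slope[of "max 0 (p - \<epsilon>)" p] p \<epsilon> by (force simp: dist_real_def)
  show thesis
    by (rule that[of \<epsilon> m m']) (use m m' \<epsilon> in \<open>auto simp: abs_less_iff\<close>)
qed

text \<open>A component of an open set is also relatively closed, its complement in the set being a union
  of open components.\<close>

lemma compact_inter_component:
  fixes U :: "real set"
  assumes "open U" "compact S" "S \<subseteq> U" "C \<in> components U"
  shows "compact (S \<inter> C)"
proof -
  have "S \<inter> C = S - \<Union>(components U - {C})"
    using assms in_components_unions_complement[OF assms(4)] by blast
  moreover have "open (\<Union>(components U - {C}))"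
    by (rule open_Union) (use assms(1) open_components in blast)
  ultimately show ?thesis using assms(2) by (simp add: compact_diff)
qed

text \<open>The components are a disjoint open cover, so a finite subcover of the compact set must contain
  every component meeting it.\<close>

lemma finite_components_meeting_compact:
  fixes U :: "real set"
  assumes "open U" "compact S" "S \<subseteq> U"
  shows "finite {C \<in> components U. C \<inter> S \<noteq> {}}"
proof -
  obtain \<D> where \<D>: "\<D> \<subseteq> components U" "finite \<D>" "S \<subseteq> \<Union>\<D>"
    by (rule compactE[OF assms(2), of "components U"])
      (use assms open_components[OF assms(1)] in auto)
  have "C \<in> \<D>" if "C \<in> components U" "C \<inter> S \<noteq> {}" for C
    using that \<D> components_eq[of C U] by blast
  then have "{C \<in> components U. C \<inter> S \<noteq> {}} \<subseteq> \<D>" by blast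
  then show ?thesis using \<D>(2) by (rule finite_subset)
qed

section \<open>A group of piecewise linear homeomorphisms acting on the interval\<close>

locale PL0_subgroup =
  fixes H :: "(real \<Rightarrow> real) set"
  assumes subgroup_H: "subgroup H PL0"
begin

text \<open>A defined constant, and not an abbreviation, because the simplifier would rewrite the
  multiplication of the updated record to that of \<^const>\<open>PL0\<close>, to which the lemmas of the
  locale \<^locale>\<open>group\<close> interpreted here do not apply.\<close>

definition G :: "(real \<Rightarrow> real) monoid" where "G = PL0\<lparr>carrier := H\<rparr>"

lemma carrier_G [simp]: "carrier G = H"
  by (simp add: G_def)

lemma carrier_update_G: "G\<lparr>carrier := K\<rparr> = PL0\<lparr>carrier := K\<rparr>"
  by (simp add: G_def)

sublocale group G
  unfolding G_def by (rule subgroup.subgroup_is_group[OF subgroup_H group_PL0])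

lemma in_PL0_maps: "u \<in> H \<Longrightarrow> u \<in> PL0_maps"
  using subgroup.subset[OF subgroup_H] by (auto simp: PL0_def)

lemma in_unit_interval: "u \<in> H \<Longrightarrow> x \<in> {0..1} \<Longrightarrow> u x \<in> {0..1}"
  by (rule PL0_maps_range[OF in_PL0_maps])

lemma mult_apply: "u \<in> H \<Longrightarrow> v \<in> H \<Longrightarrow> x \<in> {0..1} \<Longrightarrow> (u \<otimes>\<^bsub>G\<^esub> v) x = u (v x)"
  using in_PL0_maps PL0_maps_subset_Bij by (auto simp: G_def PL0_def BijGroup_def compose_def subset_iff)

lemma one_apply: "x \<in> {0..1} \<Longrightarrow> \<one>\<^bsub>G\<^esub> x = x"
  by (simp add: G_def PL0_def BijGroup_def)

lemma mult_in [simp]: "u \<in> H \<Longrightarrow> v \<in> H \<Longrightarrow> u \<otimes>\<^bsub>G\<^esub> v \<in> H"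
  using m_closed by simp

lemma inv_in [simp]: "u \<in> H \<Longrightarrow> inv\<^bsub>G\<^esub> u \<in> H"
  using inv_closed by simp

lemma one_in [simp]: "\<one>\<^bsub>G\<^esub> \<in> H"
  using one_closed by simp

lemma pow_in [simp]: "u \<in> H \<Longrightarrow> u [^]\<^bsub>G\<^esub> (i::int) \<in> H"
  using int_pow_closed by simp

lemma apply_inv: "u \<in> H \<Longrightarrow> x \<in> {0..1} \<Longrightarrow> u ((inv\<^bsub>G\<^esub> u) x) = x"
  using mult_apply[of u "inv\<^bsub>G\<^esub> u" x] one_apply r_inv[of u] by simp

lemma inv_apply: "u \<in> H \<Longrightarrow> x \<in> {0..1} \<Longrightarrow> (inv\<^bsub>G\<^esub> u) (u x) = x"
  using mult_apply[of "inv\<^bsub>G\<^esub> u" u x] one_apply l_inv[of u] by simp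

lemma apply_less_iff: "u \<in> H \<Longrightarrow> x \<in> {0..1} \<Longrightarrow> y \<in> {0..1} \<Longrightarrow> u x < u y \<longleftrightarrow> x < y"
  by (rule strict_mono_on_less[OF PL0_maps_strict_mono[OF in_PL0_maps]])

lemma apply_le_iff: "u \<in> H \<Longrightarrow> x \<in> {0..1} \<Longrightarrow> y \<in> {0..1} \<Longrightarrow> u x \<le> u y \<longleftrightarrow> x \<le> y"
  by (simp add: apply_less_iff flip: not_less)

lemma apply_eq_iff: "u \<in> H \<Longrightarrow> x \<in> {0..1} \<Longrightarrow> y \<in> {0..1} \<Longrightarrow> u x = u y \<longleftrightarrow> x = y"
  by (metis inv_apply)

lemma continuous_on_unit_interval: "u \<in> H \<Longrightarrow> continuous_on {0..1} u"
  using in_PL0_maps[of u] by (auto simp: PL0_maps_def homeomorphism_def)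

lemma eqI: "u \<in> H \<Longrightarrow> v \<in> H \<Longrightarrow> (\<And>x. x \<in> {0..1} \<Longrightarrow> u x = v x) \<Longrightarrow> u = v"
  using in_PL0_maps by (metis (no_types, lifting) PL0_maps_def extensionalityI mem_Collect_eq)

text \<open>A monotone map pushes the iterates of a point ever further in the direction of the first
  step.\<close>

lemma pow_moves:
  assumes u: "u \<in> H" and x: "x \<in> {0..1}" "u x \<noteq> x" and n: "0 < n"
  shows "(u [^]\<^bsub>G\<^esub> (n::nat)) x \<noteq> x"
proof -
  have pow: "u [^]\<^bsub>G\<^esub> k \<in> H" for k :: nat using nat_pow_closed[of u k] u by simp
  have ux: "u x \<in> {0..1}" by (rule in_unit_interval[OF u x(1)])
  have step: "(u [^]\<^bsub>G\<^esub> Suc k) x = (u [^]\<^bsub>G\<^esub> k) (u x)" for k :: nat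
    using mult_apply[OF pow u x(1)] by simp
  have up: "x < (u [^]\<^bsub>G\<^esub> Suc k) x" if "x < u x" for k
  proof (induction k)
    case (Suc k)
    then show ?case
      using apply_less_iff[OF pow x(1) ux, of "Suc k"] that step[of "Suc k"] by linarith
  qed (use u that in simp)
  have down: "(u [^]\<^bsub>G\<^esub> Suc k) x < x" if "u x < x" for k
  proof (induction k)
    case (Suc k)
    then show ?case
      using apply_less_iff[OF pow ux x(1), of "Suc k"] that step[of "Suc k"] by linarith
  qed (use u that in simp)
  obtain k where "n = Suc k" using n gr0_implies_Suc by blast
  then show ?thesis using up[of k] down[of k] x(2) by (metis less_irrefl linorder_neqE)
qed

section \<open>Global fixpoints and the components of their complement\<close>

definition fixpoints :: "real set" where
  "fixpoints = {x \<in> {0..1}. \<forall>u\<in>H. u x = x}"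

definition moved :: "real set" where
  "moved = {0..1} - fixpoints"

lemma fixpointsD: "p \<in> fixpoints \<Longrightarrow> p \<in> {0..1}" "p \<in> fixpoints \<Longrightarrow> u \<in> H \<Longrightarrow> u p = p"
  by (auto simp: fixpoints_def)

lemma movedD: "x \<in> moved \<Longrightarrow> x \<in> {0..1}"
  by (simp add: moved_def)

lemma closed_fixpoints: "closed fixpoints"
proof -
  have "closed {x \<in> {0..1}. u x = x}" if "u \<in> H" for u
    using continuous_closed_preimage_constant[of "{0..1}" "\<lambda>x. u x - x" 0]
      continuous_on_unit_interval[OF that] by (simp add: continuous_on_diff continuous_on_id)
  moreover have "fixpoints = {0..1} \<inter> (\<Inter>u\<in>H. {x \<in> {0..1}. u x = x})"
    by (auto simp: fixpoints_def)
  ultimately show ?thesis by auto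
qed

lemma endpoints_fixed: "0 \<in> fixpoints" "1 \<in> fixpoints"
proof -
  have "u 0 = 0" "u 1 = 1" if "u \<in> H" for u
  proof -
    have "u 0 \<le> u ((inv\<^bsub>G\<^esub> u) 0)" "u ((inv\<^bsub>G\<^esub> u) 1) \<le> u 1"
      using that in_unit_interval[of "inv\<^bsub>G\<^esub> u" 0] in_unit_interval[of "inv\<^bsub>G\<^esub> u" 1]
      by (simp_all add: apply_le_iff)
    then show "u 0 = 0" "u 1 = 1"
      using that in_unit_interval[of u 0] in_unit_interval[of u 1] by (simp_all add: apply_inv)
  qed
  then show "0 \<in> fixpoints" "1 \<in> fixpoints" by (auto simp: fixpoints_def)
qed

lemma open_moved: "open moved"
proof -
  have "x \<in> moved \<longleftrightarrow> x \<in> {0<..<1} - fixpoints" for x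
    using endpoints_fixed by (cases "x = 0"; cases "x = 1") (auto simp: moved_def)
  then have "moved = {0<..<1} - fixpoints" by blast
  then show ?thesis using closed_fixpoints by (simp add: open_Diff)
qed

text \<open>Monotone maps that fix \<open>p\<close> keep points on their side of \<open>p\<close>. Hence no global fixpoint separates
  \<open>x\<close> from \<open>u x\<close>, and the segment between them stays inside one component.\<close>

lemma component_invariant:
  assumes "C \<in> components moved" "x \<in> C" "u \<in> H"
  shows "u x \<in> C"
proof -
  have x: "x \<in> moved" using assms(1,2) in_components_subset by blast
  have x01: "x \<in> {0..1}" "u x \<in> {0..1}" using movedD[OF x] in_unit_interval assms(3) by blast+
  have "y \<in> moved" if y: "y \<in> closed_segment x (u x)" for y
  proof (rule ccontr)
    have y01: "y \<in> {0..1}" using y x01 by (auto simp: closed_segment_eq_real_ivl split: if_splits)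
    assume "y \<notin> moved"
    then have "y \<in> fixpoints" using y01 by (simp add: moved_def)
    then have "u y = y" using assms(3) fixpointsD by blast
    then have "x = y"
      using y apply_le_iff[OF assms(3) y01 x01(1)] apply_le_iff[OF assms(3) x01(1) y01]
      by (auto simp: closed_segment_eq_real_ivl split: if_splits)
    then show False using x \<open>y \<notin> moved\<close> by simp
  qed
  then have "closed_segment x (u x) \<subseteq> C"
    by (intro components_maximal[OF assms(1)]) (use assms(2) in auto)
  then show ?thesis by auto
qed

lemma in_component: "C \<in> components moved \<Longrightarrow> x \<in> C \<Longrightarrow> x \<in> {0..1}"
  using in_components_subset movedD by blast

text \<open>Otherwise the orbit of \<open>c\<close> is bounded by \<open>d\<close>, and its supremum lies in \<open>[c, d] \<subseteq> C\<close>. But the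
  orbit is invariant under \<open>H\<close>, and so is its supremum: it would be a global fixpoint in \<open>C\<close>.\<close>

lemma component_expanding_element:
  assumes C: "C \<in> components moved" and cd: "c \<in> C" "d \<in> C"
  shows "\<exists>h\<in>H. d < h c"
proof (rule ccontr)
  assume "\<not> ?thesis"
  then have le: "h c \<le> d" if "h \<in> H" for h using that by (auto simp: not_less)
  have c01: "c \<in> {0..1}" "d \<in> {0..1}" using in_component C cd by blast+
  define s where "s = (SUP h\<in>H. h c)"
  have bdd: "bdd_above ((\<lambda>h. h c) ` H)" by (rule bdd_aboveI[of _ d]) (use le in auto)
  have upper: "h c \<le> s" if "h \<in> H" for h
    unfolding s_def using bdd that by (rule cSUP_upper2) simp
  have sd: "s \<le> d" unfolding s_def by (rule cSUP_least) (use le one_in in blast)+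
  have cs: "c \<le> s" using upper[OF one_in] one_apply[OF c01(1)] by simp
  have s01: "s \<in> {0..1}" using cs sd c01 by auto
  have below: "u s \<le> s" if u: "u \<in> H" for u
  proof (rule ccontr)
    assume "\<not> u s \<le> s"
    then have "(inv\<^bsub>G\<^esub> u) s < s"
      using apply_less_iff[of "inv\<^bsub>G\<^esub> u" s "u s"] u s01 in_unit_interval[OF u s01]
      by (simp add: inv_apply)
    then obtain k where k: "k \<in> H" "(inv\<^bsub>G\<^esub> u) s < k c"
      unfolding s_def using bdd one_in less_cSUP_iff[of H "\<lambda>h. h c"] by blast
    have "s < u (k c)"
      using k u s01 c01 apply_less_iff[of u "(inv\<^bsub>G\<^esub> u) s" "k c"] in_unit_interval[of k c]
        in_unit_interval[of "inv\<^bsub>G\<^esub> u" s]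
      by (simp add: apply_inv)
    also have "\<dots> \<le> s" using upper[of "u \<otimes>\<^bsub>G\<^esub> k"] u k c01 by (simp add: mult_apply)
    finally show False by simp
  qed
  have "u s = s" if u: "u \<in> H" for u
  proof (rule antisym[OF below[OF u]])
    show "s \<le> u s"
      using below[OF inv_in[OF u]] apply_le_iff[of u "(inv\<^bsub>G\<^esub> u) s" s] u s01
        in_unit_interval[of "inv\<^bsub>G\<^esub> u" s]
      by (simp add: apply_inv)
  qed
  then have "s \<in> fixpoints" using s01 by (simp add: fixpoints_def)
  moreover have "s \<in> C"
    using connectedD_interval[OF in_components_connected[OF C] cd cs sd] .
  ultimately show False using in_components_subset[OF C] by (auto simp: moved_def)
qed

section \<open>Elements that are the identity near the global fixpoints\<close>

definition locally_trivial :: "(real \<Rightarrow> real) \<Rightarrow> bool" where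
  "locally_trivial w \<longleftrightarrow> (\<forall>p\<in>fixpoints. \<forall>\<^sub>F x in at p within {0..1}. w x = x)"

lemma filterlim_at_fixpoint:
  assumes u: "u \<in> H" and p: "p \<in> fixpoints"
  shows "filterlim u (at p within {0..1}) (at p within {0..1})"
proof -
  have p01: "p \<in> {0..1}" "u p = p" using fixpointsD p u by blast+
  have "(u \<longlongrightarrow> p) (at p within {0..1})"
    using continuous_on_unit_interval[OF u] p01 unfolding continuous_on_def by metis
  moreover have "\<forall>\<^sub>F x in at p within {0..1}. u x \<in> {0..1} \<and> u x \<noteq> p"
    unfolding eventually_at_filter
    using in_unit_interval[OF u] apply_eq_iff[OF u _ p01(1)] p01(2)
    by (auto intro!: always_eventually)
  ultimately show ?thesis by (simp add: filterlim_at)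
qed

text \<open>Writing the commutator as \<open>(uv)(vu)\<^sup>-\<^sup>1\<close> shows at once that it fixes \<open>(vu) y\<close> whenever
  \<open>u\<close> and \<open>v\<close> commute at the point \<open>y\<close>.\<close>

definition commutator :: "(real \<Rightarrow> real) \<Rightarrow> (real \<Rightarrow> real) \<Rightarrow> real \<Rightarrow> real" where
  "commutator u v = (u \<otimes>\<^bsub>G\<^esub> v) \<otimes>\<^bsub>G\<^esub> inv\<^bsub>G\<^esub> (v \<otimes>\<^bsub>G\<^esub> u)"

lemma commutator_in [simp]: "u \<in> H \<Longrightarrow> v \<in> H \<Longrightarrow> commutator u v \<in> H"
  by (simp add: commutator_def)

lemma commutator_eq_one: "u \<in> H \<Longrightarrow> v \<in> H \<Longrightarrow> commutator u v = \<one>\<^bsub>G\<^esub> \<longleftrightarrow> u \<otimes>\<^bsub>G\<^esub> v = v \<otimes>\<^bsub>G\<^esub> u"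
  by (simp add: commutator_def inv_solve_right')

lemma commutator_apply:
  assumes "u \<in> H" "v \<in> H" "x \<in> {0..1}"
    and "u (v ((inv\<^bsub>G\<^esub> (v \<otimes>\<^bsub>G\<^esub> u)) x)) = v (u ((inv\<^bsub>G\<^esub> (v \<otimes>\<^bsub>G\<^esub> u)) x))"
  shows "commutator u v x = x"
proof -
  let ?y = "(inv\<^bsub>G\<^esub> (v \<otimes>\<^bsub>G\<^esub> u)) x"
  have y: "?y \<in> {0..1}" by (rule in_unit_interval) (use assms in simp_all)
  have "commutator u v x = u (v ?y)" using assms(1-3) y by (simp add: commutator_def mult_apply)
  also have "\<dots> = (v \<otimes>\<^bsub>G\<^esub> u) ?y" using assms y by (simp add: mult_apply)
  also have "\<dots> = x" using assms(1-3) by (simp add: apply_inv)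
  finally show ?thesis .
qed

text \<open>On each side of a common fixpoint \<open>p\<close> the maps \<open>u\<close> and \<open>v\<close> are multiplications of \<open>x - p\<close> by
  constants, and increasing maps do not exchange the sides. So \<open>u v = v u\<close> near \<open>p\<close>.\<close>

lemma locally_trivial_commutator:
  assumes u: "u \<in> H" and v: "v \<in> H"
  shows "locally_trivial (commutator u v)"
  unfolding locally_trivial_def
proof
  fix p assume p: "p \<in> fixpoints"
  let ?F = "at p within {0..1}"
  have p01: "p \<in> {0..1}" "u p = p" "v p = p" using fixpointsD p u v by blast+
  obtain \<epsilon> m m' where germ_u: "0 < \<epsilon>"
    "\<And>x. x \<in> {0..1} \<Longrightarrow> \<bar>x - p\<bar> < \<epsilon> \<Longrightarrow> u x = p + (if p \<le> x then m else m') * (x - p)"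
    using PL0_map_germ_at_fixpoint[OF in_PL0_maps[OF u] p01(1,2)] by blast
  obtain \<delta> n n' where germ_v: "0 < \<delta>"
    "\<And>x. x \<in> {0..1} \<Longrightarrow> \<bar>x - p\<bar> < \<delta> \<Longrightarrow> v x = p + (if p \<le> x then n else n') * (x - p)"
    using PL0_map_germ_at_fixpoint[OF in_PL0_maps[OF v] p01(1,3)] by blast
  let ?near = "\<lambda>x. x \<in> {0..1} \<and> \<bar>x - p\<bar> < min \<epsilon> \<delta>"
  have near: "\<forall>\<^sub>F x in ?F. ?near x"
    unfolding eventually_at using germ_u(1) germ_v(1)
    by (intro exI[of _ "min \<epsilon> \<delta>"]) (auto simp: dist_real_def)
  have "\<forall>\<^sub>F x in ?F. ?near x \<and> ?near (u x) \<and> ?near (v x)"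
    using near eventually_compose_filterlim[OF near filterlim_at_fixpoint[OF u p]]
      eventually_compose_filterlim[OF near filterlim_at_fixpoint[OF v p]]
    by (simp add: eventually_conj_iff)
  then have "\<forall>\<^sub>F x in ?F. u (v x) = v (u x)"
  proof eventually_elim
    case (elim x)
    then have x: "x \<in> {0..1}" by simp
    have same: "p \<le> u x \<longleftrightarrow> p \<le> x" "p \<le> v x \<longleftrightarrow> p \<le> x"
      using apply_le_iff[OF u p01(1) x] apply_le_iff[OF v p01(1) x] p01 by simp_all
    define a b where "a = (if p \<le> x then m else m')" and "b = (if p \<le> x then n else n')"
    have "u x - p = a * (x - p)" "v x - p = b * (x - p)"
      "u (v x) = p + a * (v x - p)" "v (u x) = p + b * (u x - p)"
      using elim same germ_u(2)[of x] germ_v(2)[of x] germ_u(2)[of "v x"] germ_v(2)[of "u x"]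
      by (simp_all add: a_def b_def)
    then show ?case by simp
  qed
  moreover have "filterlim (inv\<^bsub>G\<^esub> (v \<otimes>\<^bsub>G\<^esub> u)) ?F ?F"
    by (rule filterlim_at_fixpoint) (use u v p in simp_all)
  ultimately have
    "\<forall>\<^sub>F x in ?F. u (v ((inv\<^bsub>G\<^esub> (v \<otimes>\<^bsub>G\<^esub> u)) x)) = v (u ((inv\<^bsub>G\<^esub> (v \<otimes>\<^bsub>G\<^esub> u)) x))"
    by (rule eventually_compose_filterlim)
  moreover have "\<forall>\<^sub>F x in ?F. x \<in> {0..1}" by (simp add: eventually_at_filter)
  ultimately show "\<forall>\<^sub>F x in ?F. commutator u v x = x"
    by eventually_elim (use u v commutator_apply in blast)
qed

definition support :: "(real \<Rightarrow> real) \<Rightarrow> real set" where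
  "support w = {x \<in> {0..1}. w x \<noteq> x}"

lemma closure_support_subset_moved:
  assumes "w \<in> H" "locally_trivial w"
  shows "closure (support w) \<subseteq> moved"
proof
  fix p assume p: "p \<in> closure (support w)"
  have "closure (support w) \<subseteq> {0..1}" by (rule closure_minimal) (auto simp: support_def)
  then have p01: "p \<in> {0..1}" using p by blast
  show "p \<in> moved"
  proof (rule ccontr)
    assume "p \<notin> moved"
    then have pF: "p \<in> fixpoints" using p01 by (simp add: moved_def)
    then obtain e where e: "0 < e" "\<And>x. x \<in> {0..1} \<Longrightarrow> x \<noteq> p \<Longrightarrow> dist x p < e \<Longrightarrow> w x = x"
      using assms(2) unfolding locally_trivial_def eventually_at by metis
    obtain x where x: "x \<in> support w" "dist x p < e"
      using p e(1) unfolding closure_approachable by blast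
    moreover have "x \<noteq> p" using x(1) fixpointsD(2)[OF pF assms(1)] by (auto simp: support_def)
    ultimately show False using e(2)[of x] by (simp add: support_def)
  qed
qed

lemma compact_closure_support: "compact (closure (support w))"
  by (rule compact_closure[THEN iffD2], rule bounded_subset[of "{0..1}"]) (auto simp: support_def)

definition support_components :: "(real \<Rightarrow> real) \<Rightarrow> real set set" where
  "support_components w = {C \<in> components moved. C \<inter> support w \<noteq> {}}"

lemma finite_support_components:
  assumes "w \<in> H" "locally_trivial w"
  shows "finite (support_components w)"
proof -
  have "support_components w \<subseteq> {C \<in> components moved. C \<inter> closure (support w) \<noteq> {}}"
    using closure_subset[of "support w"] by (auto simp: support_components_def)
  then show ?thesis
    using finite_components_meeting_compact[OF open_moved compact_closure_support
        closure_support_subset_moved[OF assms]] by (rule finite_subset)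
qed

lemma support_components_nonempty:
  assumes "w \<in> H" "w \<noteq> \<one>\<^bsub>G\<^esub>"
  shows "support_components w \<noteq> {}"
proof -
  have "\<exists>x\<in>{0..1}. w x \<noteq> x"
  proof (rule ccontr)
    assume "\<not> ?thesis"
    then have "w = \<one>\<^bsub>G\<^esub>" by (intro eqI[OF assms(1) one_in]) (simp add: one_apply)
    then show False using assms(2) by simp
  qed
  then obtain x where x: "x \<in> {0..1}" "w x \<noteq> x" by blast
  then have "x \<in> moved" using fixpointsD(2)[OF _ assms(1)] by (auto simp: moved_def)
  then obtain C where "C \<in> components moved" "x \<in> C"
    using Union_components[of moved] by blast
  then show ?thesis using x by (auto simp: support_components_def support_def)
qed

lemma support_in_component_bounded:
  assumes "w \<in> H" "locally_trivial w" "C \<in> support_components w"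
  obtains c d where "c \<in> C" "d \<in> C" "C \<inter> support w \<subseteq> {c..d}"
proof -
  let ?K = "closure (support w) \<inter> C"
  have C: "C \<in> components moved" "C \<inter> support w \<noteq> {}"
    using assms(3) by (auto simp: support_components_def)
  have "compact ?K"
    by (rule compact_inter_component[OF open_moved compact_closure_support
          closure_support_subset_moved[OF assms(1,2)] C(1)])
  moreover have K: "C \<inter> support w \<subseteq> ?K" using closure_subset by blast
  moreover from K C(2) have "?K \<noteq> {}" by blast
  ultimately obtain c d where "c \<in> ?K" "\<forall>x\<in>?K. c \<le> x" "d \<in> ?K" "\<forall>x\<in>?K. x \<le> d"
    by (metis compact_attains_inf compact_attains_sup)
  then show thesis using K by (intro that[of c d]) auto
qed

section \<open>Displacing a support by conjugation\<close>

lemma conj_pow_apply: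
  assumes "h \<in> H" "w \<in> H" "x \<in> {0..1}"
  shows "conj_pow h i w x = (h [^]\<^bsub>G\<^esub> i) (w ((h [^]\<^bsub>G\<^esub> (- i)) x))"
  using assms in_unit_interval[of "h [^]\<^bsub>G\<^esub> (- i)" x] by (simp add: conj_pow_def mult_apply)

lemma pow_pow_neg_apply:
  assumes "h \<in> H" "x \<in> {0..1}"
  shows "(h [^]\<^bsub>G\<^esub> (i::int)) ((h [^]\<^bsub>G\<^esub> (- i)) x) = x"
  using assms by (simp add: int_pow_neg apply_inv)

lemma conj_pow_fixes_iff:
  assumes "h \<in> H" "w \<in> H" "x \<in> {0..1}"
  shows "conj_pow h i w x = x \<longleftrightarrow> w ((h [^]\<^bsub>G\<^esub> (- i)) x) = (h [^]\<^bsub>G\<^esub> (- i)) x"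
proof -
  let ?y = "(h [^]\<^bsub>G\<^esub> (- i)) x"
  have y: "?y \<in> {0..1}" by (rule in_unit_interval) (use assms in simp_all)
  have "conj_pow h i w x = x \<longleftrightarrow> (h [^]\<^bsub>G\<^esub> i) (w ?y) = (h [^]\<^bsub>G\<^esub> i) ?y"
    using assms by (simp add: conj_pow_apply pow_pow_neg_apply)
  also have "\<dots> \<longleftrightarrow> w ?y = ?y"
    by (rule apply_eq_iff) (use assms y in_unit_interval[OF assms(2) y] in simp_all)
  finally show ?thesis .
qed

lemma pow_shifts_beyond:
  assumes h: "h \<in> H" and cd: "c \<in> {0..1}" "c \<le> d" "d < h c"
  shows "d < (h [^]\<^bsub>G\<^esub> Suc n) c"
proof (induction n)
  case 0
  show ?case using h cd by simp
next
  case (Suc n)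
  have n: "h [^]\<^bsub>G\<^esub> Suc n \<in> H" using h nat_pow_closed[of h "Suc n"] by simp
  have "(h [^]\<^bsub>G\<^esub> Suc n) c \<le> (h [^]\<^bsub>G\<^esub> Suc n) (h c)"
    using apply_le_iff[OF n, of c "h c"] cd in_unit_interval[OF h] by simp
  also have "\<dots> = (h [^]\<^bsub>G\<^esub> Suc (Suc n)) c"
    using mult_apply[OF n h cd(1)] by simp
  finally show ?case using Suc by simp
qed

text \<open>If \<open>v\<close> moves \<open>x\<close>, then by injectivity it also moves \<open>v x\<close>. So \<open>u\<close> fixes both points, and
  both sides equal \<open>v x\<close>. The same holds with the roles exchanged.\<close>

lemma disjoint_moves_commute:
  assumes u: "u \<in> H" and v: "v \<in> H" and C: "C \<in> components moved"
    and disj: "\<And>x. x \<in> C \<Longrightarrow> u x = x \<or> v x = x"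
    and x: "x \<in> C"
  shows "u (v x) = v (u x)"
proof -
  have x01: "x \<in> {0..1}" "u x \<in> {0..1}" "v x \<in> {0..1}"
    using in_component[OF C x] in_unit_interval u v by blast+
  have "u (v x) = v x" if "v x \<noteq> x"
    using disj[OF component_invariant[OF C x v]] that apply_eq_iff[OF v x01(3,1)] by blast
  moreover have "v (u x) = u x" if "u x \<noteq> x"
    using disj[OF component_invariant[OF C x u]] that apply_eq_iff[OF u x01(2,1)] by blast
  ultimately show ?thesis using disj[OF x] by metis
qed

lemma commutator_fixes_component:
  assumes u: "u \<in> H" and v: "v \<in> H" and C: "C \<in> components moved"
    and disj: "\<And>x. x \<in> C \<Longrightarrow> u x = x \<or> v x = x"
    and x: "x \<in> C"
  shows "commutator u v x = x"
proof (rule commutator_apply[OF u v in_component[OF C x]])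
  have "(inv\<^bsub>G\<^esub> (v \<otimes>\<^bsub>G\<^esub> u)) x \<in> C"
    by (rule component_invariant[OF C x]) (use u v in simp)
  then show "u (v ((inv\<^bsub>G\<^esub> (v \<otimes>\<^bsub>G\<^esub> u)) x)) = v (u ((inv\<^bsub>G\<^esub> (v \<otimes>\<^bsub>G\<^esub> u)) x))"
    using disjoint_moves_commute[OF u v C disj] by blast
qed

text \<open>The descent step: conjugates of \<open>w\<close> by elements of \<open>H\<close> meet only components that \<open>w\<close> meets, and
  the commutator loses the component \<open>C\<close>.\<close>

lemma support_components_commutator:
  assumes w: "w \<in> H" and h: "h \<in> H" and C: "C \<in> support_components w"
    and disj: "\<And>x. x \<in> C \<Longrightarrow> w x = x \<or> conj_pow h i w x = x"
  shows "support_components (commutator w (conj_pow h i w)) \<subset> support_components w"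
proof
  let ?v = "conj_pow h i w"
  have v: "?v \<in> H" using conj_pow_closed[of h w i] w h by simp
  have C': "C \<in> components moved" using C by (simp add: support_components_def)
  show "support_components (commutator w ?v) \<subseteq> support_components w"
  proof (rule ccontr)
    assume "\<not> ?thesis"
    then obtain D where D: "D \<in> components moved" "D \<inter> support w = {}"
      and moved: "D \<inter> support (commutator w ?v) \<noteq> {}"
      by (auto simp: support_components_def)
    have "w x = x" if "x \<in> D" for x
      using that D(2) in_component[OF D(1)] by (auto simp: support_def)
    then have "commutator w ?v x = x" if "x \<in> D" for x
      using commutator_fixes_component[OF w v D(1)] that by blast
    then show False using moved by (auto simp: support_def)
  qed
  have "commutator w ?v x = x" if "x \<in> C" for x
    by (rule commutator_fixes_component[OF w v C' disj that])
  then have "C \<notin> support_components (commutator w ?v)"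
    by (auto simp: support_components_def support_def)
  then show "support_components (commutator w ?v) \<noteq> support_components w"
    using C by blast
qed

lemma subgroup_stabilizer:
  assumes "x \<in> {0..1}"
  shows "subgroup {u \<in> H. u x = x} G"
proof (rule subgroupI)
  show "{u \<in> H. u x = x} \<noteq> {}" using one_in one_apply[OF assms] by blast
next
  fix u assume u: "u \<in> {u \<in> H. u x = x}"
  then have "(inv\<^bsub>G\<^esub> u) x = x" using inv_apply[of u x] assms by simp
  then show "inv\<^bsub>G\<^esub> u \<in> {u \<in> H. u x = x}" using u by simp
qed (use assms in \<open>auto simp: mult_apply\<close>)

section \<open>Nonabelian groups contain the wreath product\<close>

theorem comm_or_wreath:
  "comm_group G \<or> (\<exists>K. subgroup K G \<and> G\<lparr>carrier := K\<rparr> \<cong> Z_wr_Z)"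
proof (cases "comm_group G")
  case False
  then obtain u v where uv: "u \<in> H" "v \<in> H" "u \<otimes>\<^bsub>G\<^esub> v \<noteq> v \<otimes>\<^bsub>G\<^esub> u"
    using group_comm_groupI by auto
  let ?P = "\<lambda>w. w \<in> H \<and> w \<noteq> \<one>\<^bsub>G\<^esub> \<and> locally_trivial w"
  have "?P (commutator u v)"
    using uv by (simp add: commutator_eq_one locally_trivial_commutator)
  then obtain w where w: "w \<in> H" "w \<noteq> \<one>\<^bsub>G\<^esub>" "locally_trivial w"
    and least: "\<And>t. ?P t \<Longrightarrow> card (support_components w) \<le> card (support_components t)"
    using ex_has_least_nat[of ?P _ "\<lambda>w. card (support_components w)"] by blast
  obtain C where C: "C \<in> support_components w"
    using support_components_nonempty[OF w(1,2)] by blast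
  have C': "C \<in> components moved" using C by (simp add: support_components_def)
  obtain x where x: "x \<in> C" "w x \<noteq> x"
    using C by (auto simp: support_components_def support_def)
  have x01: "x \<in> {0..1}" using in_component[OF C' x(1)] .
  obtain c d where cd: "c \<in> C" "d \<in> C" "C \<inter> support w \<subseteq> {c..d}"
    using support_in_component_bounded[OF w(1,3) C] .
  obtain h where h: "h \<in> H" "d < h c"
    using component_expanding_element[OF C' cd(1,2)] by blast
  have c01: "c \<in> {0..1}" using in_component[OF C' cd(1)] .
  have between: "c \<le> z \<and> z \<le> d" if "z \<in> C" "w z \<noteq> z" for z
    using that cd(3) in_component[OF C' that(1)] by (auto simp: support_def)
  then have "c \<le> d" using x order_trans by blast
  \<comment> \<open>Positive powers of \<open>h\<close> push every point of \<open>C\<close> moved by \<open>w\<close> beyond \<open>d\<close>, out of the support.\<close>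
  have displaced: "w ((h [^]\<^bsub>G\<^esub> i) z) = (h [^]\<^bsub>G\<^esub> i) z"
    if z: "z \<in> C" "w z \<noteq> z" and i: "0 < i" for z and i :: int
  proof -
    obtain n where n: "i = int (Suc n)" using i by (metis gr0_implies_Suc zero_less_imp_eq_int)
    have "d < (h [^]\<^bsub>G\<^esub> i) c"
      unfolding n int_pow_int by (rule pow_shifts_beyond[OF h(1) c01 \<open>c \<le> d\<close> h(2)])
    also have "\<dots> \<le> (h [^]\<^bsub>G\<^esub> i) z"
      using between[OF z] apply_le_iff[OF pow_in[OF h(1)] c01 in_component[OF C' z(1)]] by simp
    finally have "d < (h [^]\<^bsub>G\<^esub> i) z" .
    then show ?thesis
      using between[OF component_invariant[OF C' z(1) pow_in[OF h(1)]]] by (meson not_le)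
  qed
  \<comment> \<open>The conjugate moves \<open>z\<close> iff \<open>w\<close> moves \<open>h\<^sup>-\<^sup>i z\<close>, and one of these two points is the image of
    the other under a positive power of \<open>h\<close>, so \<open>w\<close> cannot move both.\<close>
  have disj: "w z = z \<or> conj_pow h i w z = z" if z: "z \<in> C" and i: "i \<noteq> 0" for z i
  proof -
    let ?y = "(h [^]\<^bsub>G\<^esub> (- i)) z"
    have y: "?y \<in> C" by (rule component_invariant[OF C' z pow_in[OF h(1)]])
    have "w z = z \<or> w ?y = ?y"
    proof (cases "0 < i")
      case True
      then show ?thesis
        using displaced[OF y _ True] pow_pow_neg_apply[OF h(1) in_component[OF C' z], of i] by metis
    next
      case False
      then have "0 < - i" using i by simp
      then show ?thesis using displaced[OF z] by blast
    qed
    then show ?thesis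
      using conj_pow_fixes_iff[OF h(1) w(1) in_component[OF C' z], of i] by blast
  qed
  have comm: "w \<otimes>\<^bsub>G\<^esub> conj_pow h i w = conj_pow h i w \<otimes>\<^bsub>G\<^esub> w" if "0 < i" for i
  proof (rule ccontr)
    assume ne: "\<not> ?thesis"
    let ?v = "conj_pow h i w"
    have v: "?v \<in> H" using conj_pow_closed[of h w i] w(1) h(1) by simp
    have "?P (commutator w ?v)"
      using ne w(1) v by (simp add: commutator_eq_one locally_trivial_commutator)
    then have "card (support_components w) \<le> card (support_components (commutator w ?v))"
      by (rule least)
    moreover have "card (support_components (commutator w ?v)) < card (support_components w)"
    proof (rule psubset_card_mono[OF finite_support_components[OF w(1,3)]])
      show "support_components (commutator w ?v) \<subset> support_components w"
        by (rule support_components_commutator[OF w(1) h(1) C])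
          (rule disj[OF _ less_imp_neq[OF that, symmetric]])
    qed
    ultimately show False by linarith
  qed
  have "\<exists>K. subgroup K G \<and> G\<lparr>carrier := K\<rparr> \<cong> Z_wr_Z"
  proof (rule wreath_criterion)
    show "subgroup {u \<in> H. u x = x} G" by (rule subgroup_stabilizer[OF x01])
    show "conj_pow h i w \<in> {u \<in> H. u x = x}" if "i \<noteq> 0" for i
      using disj[OF x(1) that] x(2) conj_pow_closed[of h w i] w(1) h(1) by simp
    show "w [^]\<^bsub>G\<^esub> n \<notin> {u \<in> H. u x = x}" if "0 < n" for n :: nat
      using pow_moves[OF w(1) x01 x(2) that] by simp
    show "w \<otimes>\<^bsub>G\<^esub> conj_pow h i w = conj_pow h i w \<otimes>\<^bsub>G\<^esub> w" if "0 < i" for i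
      by (rule comm[OF that])
  qed (use w h in simp_all)
  then show ?thesis by blast
qed simp

end

theorem theorem21:
  fixes H :: "(real \<Rightarrow> real) set"
  assumes "subgroup H PL0"
  shows "comm_group (PL0\<lparr>carrier := H\<rparr>) \<or>
    (\<exists>K. subgroup K (PL0\<lparr>carrier := H\<rparr>) \<and> PL0\<lparr>carrier := K\<rparr> \<cong> Z_wr_Z)"
proof -
  have H: "PL0_subgroup H" by (rule PL0_subgroup.intro[OF assms])
  show ?thesis
    using PL0_subgroup.comm_or_wreath[OF H]
    unfolding PL0_subgroup.carrier_update_G[OF H] unfolding PL0_subgroup.G_def[OF H] .
qed

end
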